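(* Let $X$ be a real Banach space whose dual $X^*$ is isometrically isomorphic to $L_1(\mu)$ for some measure $\mu$ (an $L_1$-predual). If $X$ is octahedral, then $X$ is universally octahedral.
   Context: A Banach space $W$ is octahedral if for every finite dimensional subspace $E$ of $W$ and every $\varepsilon>0$ there exists $y\in W$, $\|y\|=1$, with $\|x+\lambda y\|\ge(1-\varepsilon)(\|x\|+|\lambda|)$ for all $x\in E$, $\lambda\in\mathbb R$. $X$ is universally octahedral if the space $L(Y,X)$ of bounded operators from $Y$ to $X$ with the operator norm is octahedral for every non-zero real Banach space $Y$. *)

theory Defs
  imports "HOL-Analysis.Analysis"
begin

definition octahedral :: "'a::real_normed_vector itself \<Rightarrow> bool" where
  "octahedral _ \<longleftrightarrow>
     (\<forall>S::'a set. finite S \<longrightarrow> (\<forall>\<epsilon>>0. \<exists>y::'a. norm y = 1 \<and>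
        (\<forall>x\<in>span S. \<forall>l::real.
           norm (x + l *\<^sub>R y) \<ge> (1 - \<epsilon>) * (norm x + \<bar>l\<bar>))))"

text \<open>T represents an isometric linear isomorphism from the dual X* = (X \<Rightarrow>L real)
  onto L1(M) (integrable functions modulo M-a.e. equality): T f is a representative
  of the class of f.\<close>
definition dual_isometric_L1 ::
  "'m measure \<Rightarrow> (('x::real_normed_vector \<Rightarrow>\<^sub>L real) \<Rightarrow> 'm \<Rightarrow> real) \<Rightarrow> bool" where
  "dual_isometric_L1 M T \<longleftrightarrow>
     (\<forall>f. integrable M (T f)) \<and>
     (\<forall>f g. AE t in M. T (f + g) t = T f t + T g t) \<and>
     (\<forall>c f. AE t in M. T (c *\<^sub>R f) t = c * T f t) \<and>
     (\<forall>f. norm f = (\<integral>t. \<bar>T f t\<bar> \<partial>M)) \<and>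
     (\<forall>g. integrable M g \<longrightarrow> (\<exists>f. AE t in M. T f t = g t))"

end

theory Submission
  imports Defs
begin

text \<open>Fix finitely many norm-one operators \<open>U i\<close> from \<open>Y\<close> to \<open>X\<close>, almost attaining their norms at unit
  vectors \<open>y i\<close>, and let \<open>g i\<close> be a norming functional of \<open>y i\<close>. By octahedrality of \<open>X\<close> there are
  functionals \<open>f i\<close> in the dual ball, almost norming \<open>U i (y i)\<close>, such that \<open>\<parallel>f i \<plusminus> f j\<parallel>\<close> is almost 2
  for \<open>i \<noteq> j\<close>; in \<open>L\<^sub>1(\<mu>)\<close> this means that they are almost disjointly supported. By Hahn-Banach
  duality for finite families, almost disjointness yields vectors \<open>x i\<close> of \<open>X\<close> with
  \<open>f i (x i)\<close> close to 1 and \<open>\<parallel>\<Sum> a i x i\<parallel> \<le> max \<bar>a i\<bar>\<close>. The finite rank operator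
  \<open>S y = \<Sum> g i (y) x i\<close> then has norm at most 1 and \<open>\<parallel>U i + S\<parallel>\<close> is almost 2 for every \<open>i\<close>. Applied to
  a finite net of the unit sphere of a finite dimensional space of operators, this is
  octahedrality of \<open>L(Y, X)\<close>.\<close>

section \<open>Hahn-Banach extension\<close>

text \<open>By homogeneity only t = 1 and t = -1 matter. They confine the value \<open>a\<close> to
  be given to \<open>w\<close> between a family of lower and a family of upper bounds, and the
  triangle inequality puts every lower bound below every upper one.\<close>

lemma Hahn_Banach_step:
  fixes G :: "('v::real_normed_vector \<times> real) set"
  assumes G: "subspace G" and le: "\<And>v r. (v, r) \<in> G \<Longrightarrow> r \<le> c * norm v" and c: "0 \<le> c"
  obtains a where "\<And>v r t. (v, r) \<in> G \<Longrightarrow> r + t * a \<le> c * norm (v + t *\<^sub>R w)"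
proof -
  define A where "A = {r - c * norm (v - w) | v r. (v, r) \<in> G}"
  have key: "r - c * norm (v - w) \<le> c * norm (v' + w) - r'"
    if "(v, r) \<in> G" "(v', r') \<in> G" for v r v' r'
  proof -
    have "(v + v', r + r') \<in> G"
      using subspace_add[OF G that] by simp
    then have "r + r' \<le> c * norm (v + v')"
      by (rule le)
    also have "norm (v + v') \<le> norm (v - w) + norm (v' + w)"
      using norm_triangle_ineq[of "v - w" "v' + w"] by simp
    finally show ?thesis
      using c by (simp add: distrib_left mult_left_mono)
  qed
  have zero: "(0, 0) \<in> G"
    using subspace_0[OF G] by (simp add: zero_prod_def)
  have bdd: "bdd_above A" unfolding A_def
    using key[OF _ zero] by (intro bdd_aboveI[of _ "c * norm (0 + w) - 0"]) blast
  define a where "a = Sup A"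
  have plus: "r + a \<le> c * norm (v + w)" if "(v, r) \<in> G" for v r
  proof -
    have "a \<le> c * norm (v + w) - r" unfolding a_def
      by (rule cSup_least) (use zero key that in \<open>auto simp: A_def\<close>)
    then show ?thesis by simp
  qed
  have minus: "r - a \<le> c * norm (v - w)" if "(v, r) \<in> G" for v r
  proof -
    have "r - c * norm (v - w) \<le> a" unfolding a_def
      by (rule cSup_upper[OF _ bdd]) (use that in \<open>auto simp: A_def\<close>)
    then show ?thesis by simp
  qed
  have "r + t * a \<le> c * norm (v + t *\<^sub>R w)" if vr: "(v, r) \<in> G" for v r t
  proof (cases t "0::real" rule: linorder_cases)
    case equal
    then show ?thesis using le[OF vr] by simp
  next
    case greater
    have "((1/t) *\<^sub>R v, r / t) \<in> G"
      using subspace_scale[OF G vr, of "1/t"] by simp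
    from plus[OF this] have "t * (r / t + a) \<le> t * (c * norm ((1/t) *\<^sub>R v + w))"
      using greater by (intro mult_left_mono) auto
    moreover have "t * norm ((1/t) *\<^sub>R v + w) = norm (v + t *\<^sub>R w)"
    proof -
      have "t * norm ((1/t) *\<^sub>R v + w) = norm (t *\<^sub>R ((1/t) *\<^sub>R v + w))"
        using greater by simp
      then show ?thesis using greater by (simp add: scaleR_add_right)
    qed
    ultimately show ?thesis using greater by (simp add: distrib_left mult.left_commute)
  next
    case less
    define s where "s = - t"
    have s: "s > 0" "t = - s" using less by (auto simp: s_def)
    have "((1/s) *\<^sub>R v, r / s) \<in> G"
      using subspace_scale[OF G vr, of "1/s"] by simp
    from minus[OF this] have "s * (r / s - a) \<le> s * (c * norm ((1/s) *\<^sub>R v - w))"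
      using s by (intro mult_left_mono) auto
    moreover have "s * norm ((1/s) *\<^sub>R v - w) = norm (v - s *\<^sub>R w)"
    proof -
      have "s * norm ((1/s) *\<^sub>R v - w) = norm (s *\<^sub>R ((1/s) *\<^sub>R v - w))"
        using s by simp
      then show ?thesis using s by (simp add: scaleR_diff_right)
    qed
    ultimately show ?thesis using s by (simp add: right_diff_distrib mult.left_commute)
  qed
  then show thesis by (rule that)
qed

text \<open>Describing the functional by its graph means that its single-valuedness need not be
  checked separately: it is part of the norm bound.\<close>

theorem Hahn_Banach_graph:
  fixes G :: "('v::real_normed_vector \<times> real) set"
  assumes G: "subspace G" and le: "\<And>v r. (v, r) \<in> G \<Longrightarrow> r \<le> c * norm v" and c: "0 \<le> c"
  obtains f :: "'v \<Rightarrow>\<^sub>L real" where "\<And>v r. (v, r) \<in> G \<Longrightarrow> f v = r" "norm f \<le> c"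
proof -
  define \<A> where "\<A> = {H. subspace H \<and> G \<subseteq> H \<and> (\<forall>(v, r)\<in>H. r \<le> c * norm v)}"
  have "\<exists>M\<in>\<A>. \<forall>X\<in>\<A>. M \<subseteq> X \<longrightarrow> X = M"
  proof (rule subset_Zorn_nonempty)
    show "\<A> \<noteq> {}"
      using G le by (auto simp: \<A>_def)
    fix \<C> assume ne: "\<C> \<noteq> {}" and ch: "subset.chain \<A> \<C>"
    have sub: "\<C> \<subseteq> \<A>" and lin: "\<And>X Y. X \<in> \<C> \<Longrightarrow> Y \<in> \<C> \<Longrightarrow> X \<subseteq> Y \<or> Y \<subseteq> X"
      using ch by (auto simp: subset_chain_def)
    have sC: "\<And>X. X \<in> \<C> \<Longrightarrow> subspace X" and GC: "\<And>X. X \<in> \<C> \<Longrightarrow> G \<subseteq> X"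
      and leC: "\<And>X v r. X \<in> \<C> \<Longrightarrow> (v, r) \<in> X \<Longrightarrow> r \<le> c * norm v"
      using sub by (auto simp: \<A>_def)
    have "subspace (\<Union>\<C>)"
      unfolding subspace_def
    proof (intro conjI ballI allI)
      show "0 \<in> \<Union>\<C>"
        using ne sC subspace_0 by blast
    next
      fix x y assume "x \<in> \<Union>\<C>" "y \<in> \<Union>\<C>"
      then obtain X Y where XY: "X \<in> \<C>" "Y \<in> \<C>" "x \<in> X" "y \<in> Y" by auto
      then obtain Z where "Z \<in> \<C>" "x \<in> Z" "y \<in> Z"
        using lin[of X Y] by blast
      then show "x + y \<in> \<Union>\<C>"
        using sC subspace_add[of Z x y] by blast
    next
      fix a x assume "x \<in> \<Union>\<C>"
      then show "a *\<^sub>R x \<in> \<Union>\<C>"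
        using sC subspace_scale by blast
    qed
    then show "\<Union>\<C> \<in> \<A>"
      using ne GC leC by (auto simp: \<A>_def)
  qed
  then obtain M where M: "M \<in> \<A>" and max: "\<And>X. X \<in> \<A> \<Longrightarrow> M \<subseteq> X \<Longrightarrow> X = M"
    by blast
  have sM: "subspace M" and GM: "G \<subseteq> M" and leM: "\<And>v r. (v, r) \<in> M \<Longrightarrow> r \<le> c * norm v"
    using M by (auto simp: \<A>_def)
  \<comment> \<open>Adjoining \<open>(w, a)\<close> to \<open>M\<close> does not leave
    \<open>\<A>\<close>, so by maximality the pair already lies in \<open>M\<close>.\<close>
  have total: "\<exists>a. (w, a) \<in> M" for w
  proof -
    obtain a where a: "\<And>v r t. (v, r) \<in> M \<Longrightarrow> r + t * a \<le> c * norm (v + t *\<^sub>R w)"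
      using Hahn_Banach_step[OF sM leM c] by blast
    define M' where "M' = span (insert (w, a) M)"
    have "M' \<in> \<A>"
    proof -
      have "r \<le> c * norm v" if vr: "(v, r) \<in> M'" for v r
      proof -
        obtain k where "(v, r) - k *\<^sub>R (w, a) \<in> span M"
          using vr by (auto simp: M'_def span_insert)
        then have "(v - k *\<^sub>R w, r - k * a) \<in> M"
          using sM by (simp add: span_eq_iff[THEN iffD2])
        from a[OF this, of k] show ?thesis by simp
      qed
      then show ?thesis
        using GM unfolding \<A>_def M'_def by (auto intro: span_base)
    qed
    moreover have "M \<subseteq> M'"
      by (auto simp: M'_def intro: span_base)
    ultimately have "M' = M" by (rule max)
    then show ?thesis
      by (auto simp: M'_def intro: span_base)
  qed
  have single: "r = r'" if "(v, r) \<in> M" "(v, r') \<in> M" for v r r'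
  proof -
    \<comment> \<open>At the vector 0 the bound is \<open>c * norm 0 = 0\<close>, for the difference
      and for its negative.\<close>
    have "(0, r - r') \<in> M" "(0, r' - r) \<in> M"
      using subspace_diff[OF sM that] subspace_diff[OF sM that(2,1)] by auto
    from this[THEN leM] show ?thesis by simp
  qed
  define f where "f v = (SOME a. (v, a) \<in> M)" for v
  have fM: "(v, f v) \<in> M" for v
    unfolding f_def using total by (rule someI_ex)
  have fI: "f v = r" if "(v, r) \<in> M" for v r
    using single[OF fM that] .
  have bound: "norm (f v) \<le> c * norm v" for v
  proof -
    have "(- v, - f v) \<in> M"
      using subspace_neg[OF sM fM[of v]] by simp
    from leM[OF this] leM[OF fM[of v]] show ?thesis by auto
  qed
  have bl: "bounded_linear f"
  proof (rule bounded_linear_intro)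
    show "f (x + y) = f x + f y" for x y
      using subspace_add[OF sM fM[of x] fM[of y]] by (intro fI) simp
    show "f (k *\<^sub>R x) = k *\<^sub>R f x" for k x
      using subspace_scale[OF sM fM[of x], of k] by (intro fI) simp
    show "norm (f v) \<le> norm v * c" for v
      using bound[of v] by (simp add: mult.commute)
  qed
  show thesis
  proof (rule that[of "Blinfun f"])
    show "Blinfun f v = r" if "(v, r) \<in> G" for v r
      using that GM fI by (auto simp: bounded_linear_Blinfun_apply[OF bl])
    show "norm (Blinfun f) \<le> c"
      using c bound by (intro norm_blinfun_bound) (auto simp: bounded_linear_Blinfun_apply[OF bl])
  qed
qed

lemma norming_functional:
  fixes x :: "'v::real_normed_vector"
  obtains f :: "'v \<Rightarrow>\<^sub>L real" where "norm f \<le> 1" "f x = norm x"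
proof -
  have "r \<le> 1 * norm v" if "(v, r) \<in> span {(x, norm x)}" for v r
    using that by (auto simp: span_singleton intro!: mult_right_mono[OF abs_ge_self])
  from Hahn_Banach_graph[OF subspace_span this] obtain f :: "'v \<Rightarrow>\<^sub>L real"
    where f: "\<And>v r. (v, r) \<in> span {(x, norm x)} \<Longrightarrow> f v = r" "norm f \<le> 1"
    by auto
  show thesis
    by (rule that[OF f(2) f(1)]) (auto intro: span_base)
qed

text \<open>The space of families with the norm of the hypothesis embeds isometrically into
  \<open>\<ell>\<^sub>\<infinity>(X)\<close>, realised here as the bounded functions on the discrete space of natural
  numbers; a Hahn-Banach extension to that space splits into its coordinates.\<close>

lemma functional_family_decomposition:
  fixes f :: "nat \<Rightarrow> ('x::real_normed_vector \<Rightarrow>\<^sub>L real)" and \<sigma> :: "nat \<Rightarrow> nat \<Rightarrow> real"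
  assumes c: "0 \<le> c"
    and le: "\<And>x b. (\<And>m. m < K \<Longrightarrow> norm (\<Sum>i<n. \<sigma> m i *\<^sub>R x i) \<le> b) \<Longrightarrow> 0 \<le> b \<Longrightarrow>
                (\<Sum>i<n. f i (x i)) \<le> c * b"
  obtains h :: "nat \<Rightarrow> ('x \<Rightarrow>\<^sub>L real)"
  where "(\<Sum>m<K. norm (h m)) \<le> c" "\<And>i. i < n \<Longrightarrow> f i = (\<Sum>m<K. \<sigma> m i *\<^sub>R h m)"
proof -
  \<comment> \<open>The cut-off at \<open>K\<close> makes every family bounded; the range of
    \<open>D\<close> is a copy of the product of \<open>K\<close> copies of X with the maximum
    norm.\<close>
  define D :: "(nat \<Rightarrow> 'x) \<Rightarrow> (nat \<Rightarrow>\<^sub>C 'x)"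
    where "D v = Bcontfun (\<lambda>k. if k < K then v k else 0)" for v
  have D: "apply_bcontfun (D v) = (\<lambda>k. if k < K then v k else 0)" for v
  proof -
    have "range (\<lambda>k. if k < K then v k else 0) \<subseteq> insert 0 (v ` {..<K})" by auto
    then have "bounded (range (\<lambda>k. if k < K then v k else 0))"
      by (rule bounded_subset[rotated]) (simp add: finite_imp_bounded)
    then have "(\<lambda>k. if k < K then v k else 0) \<in> bcontfun"
      by (auto simp: bcontfun_def)
    then show ?thesis by (simp add: D_def Bcontfun_inverse)
  qed
  have D_norm: "norm (D v) \<le> b" if "0 \<le> b" "\<And>m. m < K \<Longrightarrow> norm (v m) \<le> b" for v b
    by (rule norm_bound) (use that in \<open>auto simp: D\<close>)
  have D_ge: "norm (v m) \<le> norm (D v)" if "m < K" for v m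
    using norm_bounded[of "D v" m] that by (simp add: D)
  have D_add: "D (\<lambda>m. v m + w m) = D v + D w" for v w
    by (rule bcontfun_eqI) (simp add: D)
  have D_scale: "D (\<lambda>m. r *\<^sub>R v m) = r *\<^sub>R D v" for v r
    by (rule bcontfun_eqI) (simp add: D)
  define G where "G = {(D (\<lambda>m. \<Sum>i<n. \<sigma> m i *\<^sub>R x i), \<Sum>i<n. f i (x i)) | x. True}"
  have GI: "(D (\<lambda>m. \<Sum>i<n. \<sigma> m i *\<^sub>R x i), \<Sum>i<n. f i (x i)) \<in> G" for x
    unfolding G_def by (intro CollectI exI[of _ x]) simp
  have G: "subspace G"
    unfolding subspace_def
  proof (intro conjI ballI allI)
    have "D (\<lambda>m. \<Sum>i<n. \<sigma> m i *\<^sub>R 0) = 0"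
      by (rule bcontfun_eqI) (simp add: D)
    then show "0 \<in> G"
      using GI[of "\<lambda>i. 0"] by (simp add: zero_prod_def)
  next
    fix p q assume "p \<in> G" "q \<in> G"
    then obtain x y where
      "p = (D (\<lambda>m. \<Sum>i<n. \<sigma> m i *\<^sub>R x i), \<Sum>i<n. f i (x i))"
      "q = (D (\<lambda>m. \<Sum>i<n. \<sigma> m i *\<^sub>R y i), \<Sum>i<n. f i (y i))"
      unfolding G_def by blast
    then have "p + q = (D (\<lambda>m. \<Sum>i<n. \<sigma> m i *\<^sub>R (x i + y i)), \<Sum>i<n. f i (x i + y i))"
      by (simp add: scaleR_add_right sum.distrib D_add blinfun.add_right)
    then show "p + q \<in> G" using GI[of "\<lambda>i. x i + y i"] by simp
  next
    fix r p assume "p \<in> G"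
    then obtain x where "p = (D (\<lambda>m. \<Sum>i<n. \<sigma> m i *\<^sub>R x i), \<Sum>i<n. f i (x i))"
      unfolding G_def by blast
    then have "r *\<^sub>R p = (r *\<^sub>R D (\<lambda>m. \<Sum>i<n. \<sigma> m i *\<^sub>R x i), \<Sum>i<n. f i (r *\<^sub>R x i))"
      by (simp add: sum_distrib_left blinfun.scaleR_right)
    also have "r *\<^sub>R D (\<lambda>m. \<Sum>i<n. \<sigma> m i *\<^sub>R x i) = D (\<lambda>m. \<Sum>i<n. \<sigma> m i *\<^sub>R (r *\<^sub>R x i))"
      by (simp add: D_scale[symmetric] scaleR_sum_right mult.commute)
    finally show "r *\<^sub>R p \<in> G" using GI[of "\<lambda>i. r *\<^sub>R x i"] by simp
  qed
  have leG: "r \<le> c * norm v" if vr: "(v, r) \<in> G" for v r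
  proof -
    obtain x where x: "v = D (\<lambda>m. \<Sum>i<n. \<sigma> m i *\<^sub>R x i)" "r = (\<Sum>i<n. f i (x i))"
      using vr unfolding G_def by blast
    show ?thesis
      unfolding x(2) by (rule le) (auto simp: x(1) D_ge[of _ "\<lambda>m. \<Sum>i<n. \<sigma> m i *\<^sub>R x i"])
  qed
  obtain \<phi> :: "(nat \<Rightarrow>\<^sub>C 'x) \<Rightarrow>\<^sub>L real"
    where \<phi>: "\<And>v r. (v, r) \<in> G \<Longrightarrow> \<phi> v = r" "norm \<phi> \<le> c"
    using Hahn_Banach_graph[OF G leG c] by blast
  \<comment> \<open>The embedding of X as coordinate \<open>m\<close>; composing it with
    \<open>\<phi>\<close> gives the component \<open>h m\<close>.\<close>
  define E where "E m x = D (\<lambda>k. if k = m then x else 0)" for m x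
  have E_add: "E m (x + y) = E m x + E m y" for m x y
    by (rule bcontfun_eqI) (simp add: E_def D)
  have E_scale: "E m (r *\<^sub>R x) = r *\<^sub>R E m x" for m r x
    by (rule bcontfun_eqI) (simp add: E_def D)
  define h where "h m = Blinfun (\<lambda>x. \<phi> (E m x))" for m
  have h: "h m x = \<phi> (E m x)" for m x
  proof -
    have "bounded_linear (\<lambda>x. \<phi> (E m x))"
    proof (rule bounded_linear_intro)
      show "\<phi> (E m (x + y)) = \<phi> (E m x) + \<phi> (E m y)" for x y
        by (simp add: E_add blinfun.add_right)
      show "\<phi> (E m (r *\<^sub>R x)) = r *\<^sub>R \<phi> (E m x)" for r x
        by (simp add: E_scale blinfun.scaleR_right)
      show "norm (\<phi> (E m x)) \<le> norm x * norm \<phi>" for x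
      proof -
        have "norm (E m x) \<le> norm x"
          unfolding E_def by (rule D_norm) simp_all
        then have "norm \<phi> * norm (E m x) \<le> norm \<phi> * norm x"
          by (rule mult_left_mono) simp
        with norm_blinfun[of \<phi> "E m x"] show ?thesis
          by (simp add: mult.commute)
      qed
    qed
    then show ?thesis
      by (simp add: h_def bounded_linear_Blinfun_apply)
  qed
  have split: "\<phi> (D v) = (\<Sum>m<K. h m (v m))" for v
  proof -
    have "D v = (\<Sum>m<K. E m (v m))"
    proof (rule bcontfun_eqI)
      have "apply_bcontfun (\<Sum>m\<in>A. E m (v m)) k = (\<Sum>m\<in>A. E m (v m) k)" for A k
        by (induction A rule: infinite_finite_induct) auto
      then show "D v k = (\<Sum>m<K. E m (v m)) k" for k
        by (simp add: E_def D)
    qed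
    then show ?thesis by (simp add: blinfun.sum_right h)
  qed
  show thesis
  proof (rule that)
    show "f i = (\<Sum>m<K. \<sigma> m i *\<^sub>R h m)" if i: "i < n" for i
    proof (rule blinfun_eqI)
      fix z :: 'x
      define x where "x j = (if j = i then z else 0)" for j
      have s: "(\<Sum>j<n. \<sigma> m j *\<^sub>R x j) = \<sigma> m i *\<^sub>R z" for m
        using i by (simp add: x_def if_distrib[of "(*\<^sub>R) (\<sigma> m i)" for i] cong: if_cong)
      have "f i z = (\<Sum>j<n. f j (x j))"
        using i by (simp add: x_def if_distrib[of "blinfun_apply (f i)" for i] cong: if_cong)
      also have "\<dots> = \<phi> (D (\<lambda>m. \<Sum>j<n. \<sigma> m j *\<^sub>R x j))"
        by (rule \<phi>(1)[symmetric, OF GI])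
      also have "\<dots> = (\<Sum>m<K. \<sigma> m i *\<^sub>R h m) z"
        by (simp add: split s blinfun.scaleR_right blinfun.sum_left blinfun.scaleR_left)
      finally show "f i z = (\<Sum>m<K. \<sigma> m i *\<^sub>R h m) z" .
    qed
    show "(\<Sum>m<K. norm (h m)) \<le> c"
    proof (rule field_le_epsilon)
      fix e :: real assume e: "e > 0"
      \<comment> \<open>Vectors almost norming the \<open>h m\<close> are assembled into one family
        \<open>x\<close> with \<open>norm (D x) \<le> 1\<close>, where \<open>\<phi>\<close> is at
        most \<open>c\<close>. The \<open>K\<close> errors add up to at most
        \<open>e\<close>.\<close>
      have "\<exists>x. norm x \<le> 1 \<and> norm (h m) - e / (real K + 1) \<le> h m x" for m
      proof (rule ccontr)
        assume "\<not> ?thesis"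
        then have *: "h m x < norm (h m) - e / (real K + 1)" if "norm x \<le> 1" for x
          using that by force
        have pos: "0 < norm (h m) - e / (real K + 1)"
          using *[of 0] by simp
        have "norm (h m) \<le> norm (h m) - e / (real K + 1)"
        proof (rule norm_blinfun_bound)
          fix x
          show "norm (h m x) \<le> (norm (h m) - e / (real K + 1)) * norm x"
          proof (cases "x = 0")
            case False
            then have "\<bar>h m (x /\<^sub>R norm x)\<bar> \<le> norm (h m) - e / (real K + 1)"
              using *[of "x /\<^sub>R norm x"] *[of "- (x /\<^sub>R norm x)"]
              by (auto simp: blinfun.minus_right)
            then show ?thesis
              using False by (simp add: blinfun.scaleR_right field_simps abs_mult)
          qed simp
        qed (use pos in simp)
        then show False using e by (simp add: divide_le_0_iff)
      qed
      then obtain x where x: "\<And>m. norm (x m) \<le> 1" "\<And>m. norm (h m) - e / (real K + 1) \<le> h m (x m)"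
        by metis
      have "(\<Sum>m<K. norm (h m)) \<le> (\<Sum>m<K. h m (x m) + e / (real K + 1))"
        using x(2) by (intro sum_mono) (simp add: algebra_simps)
      also have "\<dots> = \<phi> (D x) + real K * (e / (real K + 1))"
        by (simp add: split sum.distrib)
      also have "\<phi> (D x) \<le> c"
      proof -
        have "\<phi> (D x) \<le> norm \<phi> * norm (D x)"
          using norm_blinfun[of \<phi> "D x"] by auto
        also have "\<dots> \<le> c * 1"
          using x(1) \<phi>(2) c by (intro mult_mono D_norm) auto
        finally show ?thesis by simp
      qed
      also have "real K * (e / (real K + 1)) \<le> e"
        using e by (simp add: field_simps)
      finally show "(\<Sum>m<K. norm (h m)) \<le> c + e" by simp
    qed
  qed
qed

section \<open>Octahedral norms\<close>

text \<open>Adjoining a vector \<open>a\<close>: either \<open>a\<close> is a limit of the old span and nothing has to be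
  added to the net, or it has positive distance from it, which bounds the coefficient of \<open>a\<close>.\<close>

lemma finite_span_totally_bounded:
  fixes S :: "'a::real_normed_vector set"
  assumes "finite S" "e > 0"
  shows "\<exists>F. finite F \<and> (\<forall>x\<in>span S. norm x \<le> r \<longrightarrow> (\<exists>y\<in>F. dist x y < e))"
  using assms
proof (induction S arbitrary: r e rule: finite_induct)
  case empty
  then show ?case by (intro exI[of _ "{0}"]) auto
next
  case (insert a S)
  show ?case
  proof (cases "\<forall>d>0. \<exists>b\<in>span S. dist a b < d")
    case True
    \<comment> \<open>A net of the old span suffices: \<open>z\<close> is first moved by less than
      \<open>e/2\<close> into that span, which costs \<open>e/2\<close> in the radius. The vector
      \<open>b\<close> used for this depends on \<open>k\<close>, but the net does not.\<close>
    obtain F where F: "finite F"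
      "\<And>x. x \<in> span S \<Longrightarrow> norm x \<le> r + e/2 \<Longrightarrow> \<exists>y\<in>F. dist x y < e/2"
      using insert.IH[of "e/2" "r + e/2"] insert.prems by auto
    have "\<exists>y\<in>F. dist z y < e" if z: "z \<in> span (insert a S)" "norm z \<le> r" for z
    proof -
      obtain k where k: "z - k *\<^sub>R a \<in> span S"
        using z(1) by (auto simp: span_insert)
      obtain b where b: "b \<in> span S" "dist a b < e / (2 * (\<bar>k\<bar> + 1))"
        using True[rule_format, of "e / (2 * (\<bar>k\<bar> + 1))"] insert.prems by (auto simp: add_nonneg_pos)
      define x where "x = z - k *\<^sub>R a + k *\<^sub>R b"
      have x: "x \<in> span S"
        unfolding x_def using k b(1) by (intro span_add span_scale)
      have "dist z x = \<bar>k\<bar> * dist a b"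
        by (simp add: x_def dist_norm norm_minus_commute[of a b] flip: scaleR_diff_right)
      also have "\<dots> \<le> (\<bar>k\<bar> + 1) * dist a b"
        by (intro mult_right_mono) auto
      also have "\<dots> < e / 2"
        using b(2) by (simp add: field_simps)
      finally have zx: "dist z x < e / 2" .
      have "norm x \<le> norm z + dist z x"
        using norm_triangle_sub[of x z] by (simp add: dist_norm norm_minus_commute)
      with zx z(2) have "norm x \<le> r + e/2" by simp
      from F(2)[OF x this] obtain y where "y \<in> F" "dist x y < e/2" by blast
      moreover have "dist z y \<le> dist z x + dist x y"
        by (rule dist_triangle)
      ultimately show ?thesis
        using zx by (intro bexI[of _ y]) auto
    qed
    with F(1) show ?thesis by blast
  next
    case False
    then obtain d where d: "d > 0" "\<And>b. b \<in> span S \<Longrightarrow> d \<le> dist a b"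
      by (meson not_less)
    \<comment> \<open>The bound for \<open>norm (z - k *\<^sub>R a)\<close> that follows from
      \<open>\<bar>k\<bar> \<le> \<bar>r\<bar> / d\<close>.\<close>
    define R where "R = r + \<bar>r\<bar> / d * norm a"
    obtain F where F: "finite F" "\<And>x. x \<in> span S \<Longrightarrow> norm x \<le> R \<Longrightarrow> \<exists>y\<in>F. dist x y < e/2"
      using insert.IH[of "e/2" R] insert.prems by auto
    have "e / (2 * (norm a + 1)) > 0"
      using insert.prems by (simp add: add_nonneg_pos)
    then obtain N :: "real set" where N: "finite N"
      "{- (\<bar>r\<bar> / d)..\<bar>r\<bar> / d} \<subseteq> (\<Union>t\<in>N. ball t (e / (2 * (norm a + 1))))"
      using compact_Icc[of "- (\<bar>r\<bar> / d)" "\<bar>r\<bar> / d"] unfolding compact_eq_totally_bounded by blast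
    have "\<exists>y\<in>(\<lambda>(x, t). x + t *\<^sub>R a) ` (F \<times> N). dist z y < e"
      if z: "z \<in> span (insert a S)" "norm z \<le> r" for z
    proof -
      obtain k where k: "z - k *\<^sub>R a \<in> span S"
        using z(1) by (auto simp: span_insert)
      \<comment> \<open>For nonzero \<open>k\<close>, the vector \<open>z\<close> is
        \<open>k\<close> times the difference of \<open>a\<close> and an element of
        \<open>span S\<close>, hence has norm at least \<open>\<bar>k\<bar> * d\<close>.\<close>
      have kd: "\<bar>k\<bar> * d \<le> r"
      proof (cases "k = 0")
        case True
        then show ?thesis using z(2) norm_ge_zero[of z] by (simp del: norm_ge_zero)
      next
        case False
        have "d \<le> dist a ((-1/k) *\<^sub>R (z - k *\<^sub>R a))"
          by (intro d(2) span_scale k)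
        then have "\<bar>k\<bar> * d \<le> \<bar>k\<bar> * norm (a - (-1/k) *\<^sub>R (z - k *\<^sub>R a))"
          by (intro mult_left_mono) (auto simp: dist_norm)
        also have "\<dots> = norm (k *\<^sub>R (a - (-1/k) *\<^sub>R (z - k *\<^sub>R a)))"
          by simp
        also have "k *\<^sub>R (a - (-1/k) *\<^sub>R (z - k *\<^sub>R a)) = z"
          using False by (simp add: algebra_simps)
        finally show ?thesis using z(2) by simp
      qed
      then have k_le: "\<bar>k\<bar> \<le> \<bar>r\<bar> / d"
        using d(1) by (simp add: field_simps)
      have "norm (z - k *\<^sub>R a) \<le> norm z + \<bar>k\<bar> * norm a"
        using norm_triangle_ineq4[of z "k *\<^sub>R a"] by simp
      also have "\<dots> \<le> R"
        unfolding R_def using z(2) k_le by (intro add_mono mult_right_mono) auto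
      finally obtain y where y: "y \<in> F" "dist (z - k *\<^sub>R a) y < e/2"
        using F(2)[OF k] by blast
      have "k \<in> {- (\<bar>r\<bar> / d)..\<bar>r\<bar> / d}"
        using k_le by auto
      with N(2) obtain t where t: "t \<in> N" "dist t k < e / (2 * (norm a + 1))"
        by auto
      have "dist z (y + t *\<^sub>R a) \<le> dist (z - k *\<^sub>R a) y + dist t k * norm a"
      proof -
        have "z - (y + t *\<^sub>R a) = (z - k *\<^sub>R a - y) + (k - t) *\<^sub>R a"
          by (simp add: algebra_simps)
        also have "norm \<dots> \<le> norm (z - k *\<^sub>R a - y) + norm ((k - t) *\<^sub>R a)"
          by (rule norm_triangle_ineq)
        finally show ?thesis
          by (simp add: dist_norm abs_minus_commute)
      qed
      also have "dist t k * norm a \<le> dist t k * (norm a + 1)"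
        by (intro mult_left_mono) auto
      also have "\<dots> < e / 2"
      proof -
        have "0 < 2 * (norm a + 1)" by (simp add: add_nonneg_pos)
        then have "dist t k * (2 * (norm a + 1)) < e"
          using t(2) by (simp only: pos_less_divide_eq)
        then show ?thesis by (simp add: algebra_simps)
      qed
      finally have "dist z (y + t *\<^sub>R a) < e"
        using y(2) by simp
      with y(1) t(1) show ?thesis by force
    qed
    then show ?thesis
      using F(1) N(1) by (intro exI[of _ "(\<lambda>(x, t). x + t *\<^sub>R a) ` (F \<times> N)"]) blast
  qed
qed

text \<open>With \<open>a\<close> the larger coefficient, the combination is
  \<open>a *\<^sub>R (u + y)\<close> minus the excess \<open>(a - b) *\<^sub>R y\<close>, so its
  norm is at least \<open>a * (2 - e) - (a - b) = a + b - a * e\<close>.\<close>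

lemma norm_combination_ge:
  fixes u y :: "'a::real_normed_vector"
  assumes u: "norm u = 1" and y: "norm y = 1" and e: "2 - e \<le> norm (u + y)"
    and ab: "0 \<le> a" "0 \<le> b"
  shows "(1 - e) * (a + b) \<le> norm (a *\<^sub>R u + b *\<^sub>R y)"
proof -
  have e0: "0 \<le> e"
    using norm_triangle_ineq[of u y] u y e by simp
  have *: "(1 - e) * (a + b) \<le> norm (a *\<^sub>R u + b *\<^sub>R y)"
    if u: "norm u = 1" and y: "norm y = 1" and e: "2 - e \<le> norm (u + y)" and ab: "0 \<le> b" "b \<le> a"
    for a b and u y :: 'a
  proof -
    have "a *\<^sub>R u + b *\<^sub>R y = a *\<^sub>R (u + y) - (a - b) *\<^sub>R y"
      by (simp add: algebra_simps)
    then have "a * norm (u + y) - (a - b) \<le> norm (a *\<^sub>R u + b *\<^sub>R y)"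
      using norm_triangle_ineq2[of "a *\<^sub>R (u + y)" "(a - b) *\<^sub>R y"] ab y by simp
    moreover have "a * (2 - e) \<le> a * norm (u + y)"
      using e ab by (intro mult_left_mono) auto
    moreover have "0 \<le> b * e"
      using e0 ab by simp
    ultimately show ?thesis by (simp add: algebra_simps)
  qed
  show ?thesis
    using *[OF u y e, of b a] *[OF y u, of a b] e ab
    by (cases "b \<le> a") (auto simp: add.commute)
qed

text \<open>Reduces octahedrality to finitely many unit vectors: a net replaces the unit sphere of
  the subspace, and \<open>norm_combination_ge\<close> passes from sums of unit vectors to arbitrary
  coefficients.\<close>

lemma octahedralI:
  fixes u0 :: "'a::real_normed_vector"
  assumes u0: "norm u0 = 1"
    and ex: "\<And>(F :: 'a set) \<delta>. finite F \<Longrightarrow> (\<And>x. x \<in> F \<Longrightarrow> norm x = 1) \<Longrightarrow> \<delta> > 0 \<Longrightarrow>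
           \<exists>y. norm y \<le> 1 \<and> (\<forall>x\<in>F. 2 - \<delta> \<le> norm (x + y))"
  shows "octahedral TYPE('a)"
  unfolding octahedral_def
proof (intro allI impI)
  fix S :: "'a set" and \<epsilon> :: real
  assume S: "finite S" and \<epsilon>: "\<epsilon> > 0"
  \<comment> \<open>A loss of \<open>2 * e\<close> occurs three times: in the choice of
    \<open>y\<close>, in the passage to the net and in the normalisation of \<open>y\<close>. The
    bound by 1/8 keeps \<open>y\<close> nonzero.\<close>
  define e where "e = min \<epsilon> 1 / 8"
  have e: "e > 0" "8 * e \<le> \<epsilon>" "8 * e \<le> 1"
    using \<epsilon> by (auto simp: e_def)
  obtain F0 where F0: "finite F0"
    "\<And>x. x \<in> span S \<Longrightarrow> norm x \<le> 1 \<Longrightarrow> \<exists>q\<in>F0. dist x q < e"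
    using finite_span_totally_bounded[OF S e(1), of 1] by auto
  \<comment> \<open>Points of the net may lie off the unit sphere; those near it are replaced by
    unit vectors. Including \<open>u0\<close> in \<open>F\<close> forces \<open>norm y\<close> to be
    almost 1 even if no such point exists.\<close>
  define p where "p q = (SOME x. norm x = 1 \<and> dist x q < e)" for q :: 'a
  define F where "F = insert u0 (p ` {q \<in> F0. \<exists>x. norm x = 1 \<and> dist x q < e})"
  have p: "norm (p q) = 1 \<and> dist (p q) q < e" if "norm x = 1" "dist x q < e" for q x
    unfolding p_def by (rule someI[of _ x]) (use that in auto)
  have "finite F" "\<And>x. x \<in> F \<Longrightarrow> norm x = 1"
    using F0(1) p u0 by (auto simp: F_def)
  from ex[OF this, of "2 * e"] obtain y
    where y: "norm y \<le> 1" "\<And>x. x \<in> F \<Longrightarrow> 2 - 2 * e \<le> norm (x + y)"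
    using e by auto
  have y_ge: "1 - 2 * e \<le> norm y"
    using y(2)[of u0] norm_triangle_ineq[of u0 y] u0 by (simp add: F_def)
  define y' where "y' = y /\<^sub>R norm y"
  have ny: "norm y \<noteq> 0"
    using y_ge e by linarith
  then have y': "norm y' = 1"
    by (auto simp: y'_def)
  from ny have "y - y' = (norm y - 1) *\<^sub>R y'"
    by (simp add: y'_def scaleR_diff_left left_diff_distrib)
  then have yy': "norm (y - y') \<le> 2 * e"
    using y(1) y_ge y' by simp
  have close: "2 - \<epsilon> \<le> norm (x + y')" if x: "x \<in> span S" "norm x = 1" for x
  proof -
    obtain q where q: "q \<in> F0" "dist x q < e"
      using F0(2)[OF x(1)] x(2) by auto
    have pq: "p q \<in> F" "dist (p q) q < e"
      using p[OF x(2) q(2)] q x(2) by (auto simp: F_def)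
    have "norm (p q - x) < 2 * e"
      using dist_triangle2[of "p q" x q] pq(2) q(2) by (simp add: dist_norm)
    moreover have "p q + y = (x + y') + (p q - x) + (y - y')" by simp
    then have "norm (p q + y) \<le> norm (x + y') + norm (p q - x) + norm (y - y')"
      using norm_triangle_ineq[of "(x + y') + (p q - x)" "y - y'"]
        norm_triangle_ineq[of "x + y'" "p q - x"] by simp
    ultimately show ?thesis
      using y(2)[OF pq(1)] yy' e by linarith
  qed
  have "(1 - \<epsilon>) * (norm x + \<bar>l\<bar>) \<le> norm (x + l *\<^sub>R y')" if x: "x \<in> span S" for x l
  proof (cases "x = 0")
    case True
    have "(1 - \<epsilon>) * \<bar>l\<bar> \<le> 1 * \<bar>l\<bar>"
      using \<epsilon> by (intro mult_right_mono) auto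
    then show ?thesis using y' True by simp
  next
    case False
    \<comment> \<open>The sign of \<open>l\<close> is moved to \<open>x\<close>, so that both
      coefficients become nonnegative.\<close>
    define s :: real where "s = (if l \<ge> 0 then 1 else -1)"
    define u where "u = (s / norm x) *\<^sub>R x"
    have u: "u \<in> span S" "norm u = 1"
      using x False by (auto simp: u_def s_def intro!: span_scale span_neg)
    have "(1 - \<epsilon>) * (norm x + \<bar>l\<bar>) \<le> norm (norm x *\<^sub>R u + \<bar>l\<bar> *\<^sub>R y')"
      by (rule norm_combination_ge) (use u y' close in auto)
    also have "norm x *\<^sub>R u + \<bar>l\<bar> *\<^sub>R y' = s *\<^sub>R (x + l *\<^sub>R y')"
      using False by (auto simp: u_def s_def scaleR_add_right)
    also have "norm \<dots> = norm (x + l *\<^sub>R y')"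
      by (simp add: s_def)
    finally show ?thesis .
  qed
  with y' show "\<exists>y. norm y = 1 \<and> (\<forall>x\<in>span S. \<forall>l. (1 - \<epsilon>) * (norm x + \<bar>l\<bar>) \<le> norm (x + l *\<^sub>R y))"
    by blast
qed

text \<open>Octahedrality is applied repeatedly, each time to the span of \<open>A\<close> and the
  vectors found so far. Both the old family and the new vector get error \<open>e/2\<close>, and
  \<open>(1 - e/2)\<^sup>2 \<ge> 1 - e\<close>.\<close>

lemma octahedral_l1_family:
  fixes A :: "'x::real_normed_vector set" and m :: nat
  assumes oct: "octahedral TYPE('x)" and A: "finite A" and e: "0 < e" "e \<le> 1"
  shows "\<exists>w. (\<forall>k<m. norm (w k) = 1) \<and>
    (\<forall>z\<in>span A. \<forall>a. (1 - e) * (norm z + (\<Sum>k<m. \<bar>a k\<bar>)) \<le> norm (z + (\<Sum>k<m. a k *\<^sub>R w k)))"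
  using e
proof (induction m arbitrary: e)
  case 0
  have "(1 - e) * norm z \<le> 1 * norm z" for z :: 'x
    using 0 by (intro mult_right_mono) auto
  then show ?case by auto
next
  case (Suc m)
  obtain w where w: "\<And>k. k < m \<Longrightarrow> norm (w k) = 1"
    "\<And>z a. z \<in> span A \<Longrightarrow>
       (1 - e/2) * (norm z + (\<Sum>k<m. \<bar>a k\<bar>)) \<le> norm (z + (\<Sum>k<m. a k *\<^sub>R w k))"
    using Suc.IH[of "e/2"] Suc.prems by auto
  have "finite (A \<union> w ` {..<m})"
    using A by simp
  then obtain y where y: "norm y = 1"
    "\<And>x l. x \<in> span (A \<union> w ` {..<m}) \<Longrightarrow> (1 - e/2) * (norm x + \<bar>l\<bar>) \<le> norm (x + l *\<^sub>R y)"
    using oct[unfolded octahedral_def, rule_format, of "A \<union> w ` {..<m}" "e/2"] Suc.prems by auto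
  define w' where "w' = w(m := y)"
  have "(1 - e) * (norm z + (\<Sum>k<Suc m. \<bar>a k\<bar>)) \<le> norm (z + (\<Sum>k<Suc m. a k *\<^sub>R w' k))"
    if z: "z \<in> span A" for z a
  proof -
    define x where "x = z + (\<Sum>k<m. a k *\<^sub>R w k)"
    have x: "x \<in> span (A \<union> w ` {..<m})"
      unfolding x_def
      by (intro span_add span_sum span_scale)
        (use z span_mono[of A "A \<union> w ` {..<m}"] in \<open>auto intro: span_base\<close>)
    define s where "s = norm z + (\<Sum>k<m. \<bar>a k\<bar>)"
    have s: "0 \<le> s" by (simp add: s_def sum_nonneg)
    have "(1 - e) * (s + \<bar>a m\<bar>) \<le> (1 - e/2) * ((1 - e/2) * s + \<bar>a m\<bar>)"
    proof -
      have "(1 - e/2) * ((1 - e/2) * s + \<bar>a m\<bar>) - (1 - e) * (s + \<bar>a m\<bar>)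
          = e * e / 4 * s + e / 2 * \<bar>a m\<bar>"
        by (simp add: field_simps)
      also have "\<dots> \<ge> 0"
        using s Suc.prems by simp
      finally show ?thesis by simp
    qed
    also have "\<dots> \<le> (1 - e/2) * (norm x + \<bar>a m\<bar>)"
      using w(2)[OF z, of a] Suc.prems unfolding x_def s_def
      by (intro mult_left_mono add_right_mono) auto
    also have "\<dots> \<le> norm (x + a m *\<^sub>R y)"
      by (rule y(2)[OF x])
    also have "x + a m *\<^sub>R y = z + (\<Sum>k<Suc m. a k *\<^sub>R w' k)"
      by (simp add: x_def w'_def add.assoc)
    finally show ?thesis by (simp add: s_def add.assoc)
  qed
  moreover have "norm (w' k) = 1" if "k < Suc m" for k
    using that w(1) y(1) by (auto simp: w'_def less_Suc_eq)
  ultimately show ?case by blast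
qed

section \<open>Overlap of functionals in \<open>L\<^sub>1\<close>\<close>

text \<open>Each summand of the double sum is the minimum of \<open>\<bar>a i\<bar>\<close> and
  \<open>\<bar>a j\<bar>\<close>. The largest \<open>\<bar>a k\<bar>\<close> is at most
  \<open>H\<close>, and every other \<open>\<bar>a j\<bar>\<close> is its own minimum with
  \<open>\<bar>a k\<bar>\<close>, so row \<open>k\<close> alone accounts for the rest.\<close>

lemma sum_abs_le_bound_plus_overlap:
  fixes a :: "nat \<Rightarrow> real"
  assumes H: "0 \<le> H" "\<And>i. i < n \<Longrightarrow> \<bar>a i\<bar> \<le> H"
  shows "(\<Sum>i<n. \<bar>a i\<bar>) \<le> H +
    (\<Sum>i<n. \<Sum>j\<in>{..<n} - {i}. \<bar>a i\<bar> + \<bar>a j\<bar> - (\<bar>a i + a j\<bar> + \<bar>a i - a j\<bar>) / 2)"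
proof (cases "n = 0")
  case True
  then show ?thesis using H by simp
next
  case False
  define g where "g i j = \<bar>a i\<bar> + \<bar>a j\<bar> - (\<bar>a i + a j\<bar> + \<bar>a i - a j\<bar>) / 2" for i j
  have g: "g i j = min \<bar>a i\<bar> \<bar>a j\<bar>" for i j
    by (auto simp: g_def min_def abs_if)
  have "finite ((\<lambda>i. \<bar>a i\<bar>) ` {..<n})" "(\<lambda>i. \<bar>a i\<bar>) ` {..<n} \<noteq> {}"
    using False by auto
  from Max_in[OF this] obtain k where k: "k < n" "\<bar>a k\<bar> = Max ((\<lambda>i. \<bar>a i\<bar>) ` {..<n})"
    by auto
  have k_max: "\<bar>a i\<bar> \<le> \<bar>a k\<bar>" if "i < n" for i
    unfolding k(2) using that by (intro Max_ge) auto
  have "(\<Sum>i<n. \<bar>a i\<bar>) = \<bar>a k\<bar> + (\<Sum>j\<in>{..<n} - {k}. \<bar>a j\<bar>)"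
    using k(1) by (simp add: sum.remove)
  also have "(\<Sum>j\<in>{..<n} - {k}. \<bar>a j\<bar>) = (\<Sum>j\<in>{..<n} - {k}. g k j)"
    by (intro sum.cong) (auto simp: g min_absorb2 k_max)
  also have "\<dots> \<le> (\<Sum>i<n. \<Sum>j\<in>{..<n} - {i}. g i j)"
    using k(1) by (intro member_le_sum[of k _ "\<lambda>i. \<Sum>j\<in>{..<n} - {i}. g i j"]) (auto simp: g intro!: sum_nonneg)
  finally show ?thesis
    using H(2)[OF k(1)] by (simp add: g_def)
qed

lemma dual_isometric_L1_sum:
  fixes T :: "('x::real_normed_vector \<Rightarrow>\<^sub>L real) \<Rightarrow> 'm \<Rightarrow> real"
  assumes T: "dual_isometric_L1 M T"
  shows "AE t in M. T (\<Sum>m<(K::nat). c m *\<^sub>R h m) t = (\<Sum>m<K. c m * T (h m) t)"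
proof (induction K)
  case 0
  have "AE t in M. T (0 *\<^sub>R 0) t = 0 * T 0 t"
    using T unfolding dual_isometric_L1_def by blast
  then show ?case by simp
next
  case (Suc K)
  have "AE t in M. T ((\<Sum>m<K. c m *\<^sub>R h m) + c K *\<^sub>R h K) t
      = T (\<Sum>m<K. c m *\<^sub>R h m) t + T (c K *\<^sub>R h K) t"
    "AE t in M. T (c K *\<^sub>R h K) t = c K * T (h K) t"
    using T unfolding dual_isometric_L1_def by blast+
  with Suc show ?case by eventually_elim simp
qed

text \<open>The defects \<open>\<parallel>f\<parallel> + \<parallel>g\<parallel> - (\<parallel>f + g\<parallel> + \<parallel>f - g\<parallel>) / 2\<close> measure the overlap \<open>\<integral> min \<bar>f\<bar> \<bar>g\<bar>\<close>; so
  this bounds \<open>\<integral> max \<bar>f i\<bar>\<close> from below, up to the overlaps, by the sum of the norms.\<close>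

lemma L1_sum_norm_le:
  fixes T :: "('x::real_normed_vector \<Rightarrow>\<^sub>L real) \<Rightarrow> 'm \<Rightarrow> real"
    and f h :: "nat \<Rightarrow> ('x \<Rightarrow>\<^sub>L real)" and K n :: nat
  assumes T: "dual_isometric_L1 M T"
    and f: "\<And>i. i < n \<Longrightarrow> f i = (\<Sum>m<K. \<sigma> m i *\<^sub>R h m)"
    and \<sigma>: "\<And>m i. \<bar>\<sigma> m i\<bar> \<le> 1"
  shows "(\<Sum>i<n. norm (f i)) \<le> (\<Sum>m<K. norm (h m)) +
    (\<Sum>i<n. \<Sum>j\<in>{..<n} - {i}.
       norm (f i) + norm (f j) - (norm (f i + f j) + norm (f i - f j)) / 2)"
proof -
  have int: "integrable M (T g)" and nrm: "norm g = (\<integral>t. \<bar>T g t\<bar> \<partial>M)"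
    and add: "AE t in M. T (g + g') t = T g t + T g' t" for g g'
    using T unfolding dual_isometric_L1_def by blast+
  have diff: "AE t in M. T (g - g') t = T g t - T g' t" for g g'
  proof -
    have "AE t in M. T ((-1) *\<^sub>R g') t = -1 * T g' t"
      using T unfolding dual_isometric_L1_def by blast
    with add[of g "(-1) *\<^sub>R g'"] show ?thesis
      by eventually_elim simp
  qed
  \<comment> \<open>Finitely many pairs of indices share one null set, off which the pointwise
    inequality can be used.\<close>
  have AE_all: "AE t in M. \<forall>i\<in>{..<n}. \<forall>j\<in>{..<n}. P i j t"
    if "\<And>i j. i < n \<Longrightarrow> j < n \<Longrightarrow> AE t in M. P i j t" for P
    using that by (intro AE_finite_allI) auto
  have 1: "AE t in M. \<forall>i\<in>{..<n}. \<forall>j\<in>{..<n}. T (f i + f j) t = T (f i) t + T (f j) t"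
    by (rule AE_all) (rule add)
  have 2: "AE t in M. \<forall>i\<in>{..<n}. \<forall>j\<in>{..<n}. T (f i - f j) t = T (f i) t - T (f j) t"
    by (rule AE_all) (rule diff)
  have 3: "AE t in M. \<forall>i\<in>{..<n}. T (f i) t = (\<Sum>m<K. \<sigma> m i * T (h m) t)"
  proof (rule AE_finite_allI)
    show "AE t in M. T (f i) t = (\<Sum>m<K. \<sigma> m i * T (h m) t)" if "i \<in> {..<n}" for i
      using dual_isometric_L1_sum[OF T, where K = K and c = "\<lambda>m. \<sigma> m i" and h = h] f[of i] that by simp
  qed simp
  have "(\<Sum>i<n. norm (f i)) = (\<integral>t. (\<Sum>i<n. \<bar>T (f i) t\<bar>) \<partial>M)"
    by (simp add: nrm int)
  also have "\<dots> \<le> (\<integral>t. (\<Sum>m<K. \<bar>T (h m) t\<bar>) +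
    (\<Sum>i<n. \<Sum>j\<in>{..<n} - {i}.
       \<bar>T (f i) t\<bar> + \<bar>T (f j) t\<bar> - (\<bar>T (f i + f j) t\<bar> + \<bar>T (f i - f j) t\<bar>) / 2) \<partial>M)"
  proof (rule integral_mono_AE)
    show "AE t in M. (\<Sum>i<n. \<bar>T (f i) t\<bar>) \<le> (\<Sum>m<K. \<bar>T (h m) t\<bar>) +
      (\<Sum>i<n. \<Sum>j\<in>{..<n} - {i}.
         \<bar>T (f i) t\<bar> + \<bar>T (f j) t\<bar> - (\<bar>T (f i + f j) t\<bar> + \<bar>T (f i - f j) t\<bar>) / 2)"
      using 1 2 3
    proof eventually_elim
      case (elim t)
      \<comment> \<open>The common bound \<open>H\<close> of the pointwise inequality; the
        coefficients \<open>\<sigma> m i\<close> drop out, being at most 1 in modulus.\<close>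
      have "\<bar>T (f i) t\<bar> \<le> (\<Sum>m<K. \<bar>T (h m) t\<bar>)" if "i < n" for i
      proof -
        have "\<bar>T (f i) t\<bar> \<le> (\<Sum>m<K. \<bar>\<sigma> m i * T (h m) t\<bar>)"
          using elim(3) that by simp
        also have "\<dots> \<le> (\<Sum>m<K. \<bar>T (h m) t\<bar>)"
          by (intro sum_mono) (use \<sigma> in \<open>simp add: abs_mult mult_left_le_one_le\<close>)
        finally show ?thesis .
      qed
      then have "(\<Sum>i<n. \<bar>T (f i) t\<bar>) \<le> (\<Sum>m<K. \<bar>T (h m) t\<bar>) +
        (\<Sum>i<n. \<Sum>j\<in>{..<n} - {i}. \<bar>T (f i) t\<bar> + \<bar>T (f j) t\<bar> -
           (\<bar>T (f i) t + T (f j) t\<bar> + \<bar>T (f i) t - T (f j) t\<bar>) / 2)"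
        by (intro sum_abs_le_bound_plus_overlap) (auto intro: sum_nonneg)
      also have "(\<Sum>i<n. \<Sum>j\<in>{..<n} - {i}. \<bar>T (f i) t\<bar> + \<bar>T (f j) t\<bar> -
           (\<bar>T (f i) t + T (f j) t\<bar> + \<bar>T (f i) t - T (f j) t\<bar>) / 2) =
        (\<Sum>i<n. \<Sum>j\<in>{..<n} - {i}. \<bar>T (f i) t\<bar> + \<bar>T (f j) t\<bar> -
           (\<bar>T (f i + f j) t\<bar> + \<bar>T (f i - f j) t\<bar>) / 2)"
        using elim(1,2) by (intro sum.cong refl) auto
      finally show ?case by simp
    qed
  qed (auto intro!: Bochner_Integration.integrable_add Bochner_Integration.integrable_sum
      Bochner_Integration.integrable_diff integrable_divide integrable_abs int)
  also have "\<dots> = (\<Sum>m<K. norm (h m)) +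
    (\<Sum>i<n. \<Sum>j\<in>{..<n} - {i}.
       norm (f i) + norm (f j) - (norm (f i + f j) + norm (f i - f j)) / 2)"
    by (simp add: nrm int)
  finally show ?thesis .
qed

section \<open>Finite rank operators\<close>

text \<open>The norm is convex, so its maximum over the cube is attained at a vertex: for a
  functional norming the combination, replacing each coefficient by the sign of the functional at
  \<open>x i\<close> can only increase the value.\<close>

lemma norm_sum_le_of_signs:
  fixes x :: "nat \<Rightarrow> 'x::real_normed_vector"
  assumes signs: "\<And>s. (\<And>i. \<bar>s i\<bar> = 1) \<Longrightarrow> norm (\<Sum>i<n. s i *\<^sub>R x i) \<le> b"
    and a: "\<And>i. i < n \<Longrightarrow> \<bar>a i\<bar> \<le> 1"
  shows "norm (\<Sum>i<n. a i *\<^sub>R x i) \<le> b"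
proof -
  obtain \<phi> :: "'x \<Rightarrow>\<^sub>L real"
    where \<phi>: "norm \<phi> \<le> 1" "\<phi> (\<Sum>i<n. a i *\<^sub>R x i) = norm (\<Sum>i<n. a i *\<^sub>R x i)"
    by (rule norming_functional)
  define s where "s i = (if \<phi> (x i) \<ge> 0 then 1 else - 1 :: real)" for i
  have "norm (\<Sum>i<n. a i *\<^sub>R x i) = (\<Sum>i<n. a i * \<phi> (x i))"
    by (simp flip: \<phi>(2) add: blinfun.sum_right blinfun.scaleR_right)
  also have "\<dots> \<le> (\<Sum>i<n. s i * \<phi> (x i))"
  proof (rule sum_mono)
    fix i assume "i \<in> {..<n}"
    then have "\<bar>a i\<bar> * \<bar>\<phi> (x i)\<bar> \<le> 1 * \<bar>\<phi> (x i)\<bar>"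
      using a by (intro mult_right_mono) auto
    moreover have "s i * \<phi> (x i) = \<bar>\<phi> (x i)\<bar>"
      by (simp add: s_def)
    ultimately have "\<bar>a i * \<phi> (x i)\<bar> \<le> s i * \<phi> (x i)"
      by (simp add: abs_mult)
    then show "a i * \<phi> (x i) \<le> s i * \<phi> (x i)" by linarith
  qed
  also have "\<dots> = \<phi> (\<Sum>i<n. s i *\<^sub>R x i)"
    by (simp add: blinfun.sum_right blinfun.scaleR_right)
  also have "\<dots> \<le> norm \<phi> * norm (\<Sum>i<n. s i *\<^sub>R x i)"
    using norm_blinfun[of \<phi> "\<Sum>i<n. s i *\<^sub>R x i"] by simp
  also have "\<dots> \<le> 1 * norm (\<Sum>i<n. s i *\<^sub>R x i)"
    by (rule mult_right_mono) (use \<phi>(1) in auto)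
  also have "\<dots> \<le> b"
    using signs[of s] by (simp add: s_def)
  finally show ?thesis .
qed

text \<open>Encodes a sign pattern by the subset of indices carrying -1, so that a bound over all
  patterns becomes one over \<open>m < K\<close>, as \<open>functional_family_decomposition\<close>
  requires.\<close>

lemma finite_sign_enumeration:
  obtains \<sigma> :: "nat \<Rightarrow> nat \<Rightarrow> real" and K :: nat
  where "\<forall>m i. \<bar>\<sigma> m i\<bar> = 1"
    "\<forall>s. (\<forall>i. \<bar>s i\<bar> = 1) \<longrightarrow> (\<exists>m<K. \<forall>i<n. \<sigma> m i = s i)"
proof -
  have "finite (Pow {..<n})" by simp
  then obtain e where e: "bij_betw e {0..<card (Pow {..<n})} (Pow {..<n})"
    using ex_bij_betw_nat_finite by blast
  have "\<exists>m<card (Pow {..<n}). \<forall>i<n. (if i \<in> e m then - 1 else 1) = s i"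
    if s: "\<forall>i. \<bar>s i\<bar> = 1" for s :: "nat \<Rightarrow> real"
  proof -
    have "{i. i < n \<and> s i = - 1} \<in> e ` {0..<card (Pow {..<n})}"
      using e by (auto simp: bij_betw_def)
    then obtain m where m: "m < card (Pow {..<n})" "e m = {i. i < n \<and> s i = - 1}"
      by auto
    have "(if i \<in> e m then - 1 else 1) = s i" if "i < n" for i
      using that s[rule_format, of i] by (auto simp: m(2) abs_if split: if_splits)
    then show ?thesis
      using m(1) by blast
  qed
  then show thesis
    by (intro that[of "\<lambda>m i. if i \<in> e m then - 1 else 1" "card (Pow {..<n})"]) auto
qed

text \<open>The functionals norm vectors \<open>z i \<plusminus> w 0 \<plusminus> \<dots> \<plusminus> w n\<close>, where the \<open>w k\<close> span an \<open>\<ell>\<^sub>1\<close>-like sum with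
  the \<open>z i\<close>. The signs differ between any two of them at some \<open>w k\<close> and agree at \<open>w n\<close>.\<close>

lemma almost_disjoint_functionals:
  fixes z :: "nat \<Rightarrow> 'x::real_normed_vector"
  assumes oct: "octahedral TYPE('x)" and z: "\<And>i. i < n \<Longrightarrow> norm (z i) = 1" and \<eta>: "\<eta> > 0"
  shows "\<exists>f :: nat \<Rightarrow> ('x \<Rightarrow>\<^sub>L real). (\<forall>i. norm (f i) \<le> 1) \<and> (\<forall>i<n. 1 - \<eta> \<le> blinfun_apply (f i) (z i)) \<and>
    (\<forall>i<n. \<forall>j<n. i \<noteq> j \<longrightarrow>
       2 - 2 * \<eta> \<le> norm (f i + f j) \<and> 2 - 2 * \<eta> \<le> norm (f i - f j))"
proof -
  \<comment> \<open>Exact additivity of the norm would give \<open>v i\<close> norm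
    \<open>n + 2\<close>; this \<open>e\<close> limits the loss to \<open>\<eta>\<close>.\<close>
  define e where "e = min 1 (\<eta> / (real n + 2))"
  have e: "0 < e" "e \<le> 1" "e \<le> \<eta> / (real n + 2)"
    using \<eta> by (auto simp: e_def)
  have e_le: "e * (real n + 2) \<le> \<eta>"
    using e(3) by (subst (asm) pos_le_divide_eq) auto
  obtain w where w: "\<And>k. k < Suc n \<Longrightarrow> norm (w k) = 1"
    "\<And>x a. x \<in> span (z ` {..<n}) \<Longrightarrow>
       (1 - e) * (norm x + (\<Sum>k<Suc n. \<bar>a k\<bar>)) \<le> norm (x + (\<Sum>k<Suc n. a k *\<^sub>R w k))"
    using octahedral_l1_family[OF oct _ e(1,2), of "z ` {..<n}" "Suc n"] by blast
  define s :: "nat \<Rightarrow> nat \<Rightarrow> real" where "s i k = (if k = i then - 1 else 1)" for i k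
  define v where "v i = z i + (\<Sum>k<Suc n. s i k *\<^sub>R w k)" for i
  have "\<exists>f :: 'x \<Rightarrow>\<^sub>L real. norm f \<le> 1 \<and> blinfun_apply f (v i) = norm (v i)" for i
    using norming_functional[of "v i"] by metis
  then obtain f :: "nat \<Rightarrow> ('x \<Rightarrow>\<^sub>L real)" where f: "\<And>i. norm (f i) \<le> 1" "\<And>i. f i (v i) = norm (v i)"
    by metis
  have f_le: "\<bar>g x\<bar> \<le> norm g" if "norm x = 1" for g :: "'x \<Rightarrow>\<^sub>L real" and x
    using norm_blinfun[of g x] that by simp
  \<comment> \<open>The right side has \<open>n + 2\<close> terms, each at most 1, so a total within
    \<open>\<eta>\<close> of \<open>n + 2\<close> forces every term to be at least
    \<open>1 - \<eta>\<close>.\<close>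
  have sum_ge: "real n + 2 - \<eta> \<le> f i (z i) + (\<Sum>k<Suc n. s i k * f i (w k))" if i: "i < n" for i
  proof -
    have "z i \<in> span (z ` {..<n})"
      using i by (auto intro: span_base)
    from w(2)[OF this, of "s i"] have "(1 - e) * (1 + (\<Sum>k<Suc n. \<bar>s i k\<bar>)) \<le> norm (v i)"
      using z[OF i] by (simp add: v_def)
    moreover have "\<bar>s i k\<bar> = 1" for k
      by (simp add: s_def)
    then have "(\<Sum>k<Suc n. \<bar>s i k\<bar>) = real n + 1"
      by simp
    ultimately have "(1 - e) * (real n + 2) \<le> norm (v i)"
      by (simp add: add.commute)
    moreover have "f i (v i) = f i (z i) + (\<Sum>k<Suc n. s i k * f i (w k))"
      by (simp only: v_def blinfun.add_right blinfun.sum_right blinfun.scaleR_right real_scaleR_def)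
    ultimately show ?thesis using e_le f(2)[of i] by (simp add: algebra_simps)
  qed
  have fz_le: "f i (z i) \<le> 1" if "i < n" for i
    using f_le[OF z[OF that], of "f i"] f(1)[of i] by linarith
  have fw_le: "s i k * f i (w k) \<le> 1" if "k < Suc n" for i k
    using f_le[OF w(1)[OF that], of "f i"] f(1)[of i] by (auto simp: s_def)
  have fz: "1 - \<eta> \<le> f i (z i)" if i: "i < n" for i
  proof -
    have "(\<Sum>k<Suc n. s i k * f i (w k)) \<le> (\<Sum>k<Suc n. 1)"
      by (intro sum_mono fw_le) auto
    with sum_ge[OF i] show ?thesis by simp
  qed
  have fw: "1 - \<eta> \<le> s i k * f i (w k)" if i: "i < n" and k: "k < Suc n" for i k
  proof -
    have "(\<Sum>k<Suc n. s i k * f i (w k))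
        = s i k * f i (w k) + (\<Sum>k\<in>{..<Suc n} - {k}. s i k * f i (w k))"
      using k by (intro sum.remove) auto
    also have "(\<Sum>k\<in>{..<Suc n} - {k}. s i k * f i (w k)) \<le> (\<Sum>k\<in>{..<Suc n} - {k}. 1)"
      by (intro sum_mono fw_le) auto
    also have "\<dots> = real n"
      using k by simp
    finally show ?thesis
      using sum_ge[OF i] fz_le[OF i] by simp
  qed
  show ?thesis
  proof (intro exI[of _ f] conjI allI impI)
    show "norm (f i) \<le> 1" for i by (rule f(1))
    show "1 - \<eta> \<le> f i (z i)" if "i < n" for i using that by (rule fz)
    \<comment> \<open>The sum is tested at \<open>w n\<close>, where both functionals are almost 1,
      the difference at \<open>w j\<close>, where \<open>f i\<close> is almost 1 and
      \<open>f j\<close> almost -1.\<close>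
    show "2 - 2 * \<eta> \<le> norm (f i + f j)" if "i < n" "j < n" "i \<noteq> j" for i j
      using fw[of i n] fw[of j n] f_le[OF w(1)[of n], of "f i + f j"] that
      by (simp add: s_def blinfun.add_left)
    show "2 - 2 * \<eta> \<le> norm (f i - f j)" if "i < n" "j < n" "i \<noteq> j" for i j
      using fw[of i j] fw[of j j] f_le[OF w(1)[of j], of "f i - f j"] that
      by (simp add: s_def blinfun.diff_left)
  qed
qed

text \<open>If the \<open>x i\<close> could not be found, duality would write the \<open>f i\<close>
  through \<open>h m\<close> of total norm at most \<open>n - \<eta>\<close>. As the overlaps are
  tiny, \<open>L1_sum_norm_le\<close> would then keep the sum of the norms of the \<open>f i\<close>
  well below \<open>n\<close>, although each norm is almost 1.\<close>

lemma L1_predual_l_infty_family: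
  fixes T :: "('x::real_normed_vector \<Rightarrow>\<^sub>L real) \<Rightarrow> 'm \<Rightarrow> real" and z :: "nat \<Rightarrow> 'x"
  assumes T: "dual_isometric_L1 M T" and oct: "octahedral TYPE('x)"
    and z: "\<And>i. i < n \<Longrightarrow> norm (z i) = 1" and \<eta>: "0 < \<eta>" "\<eta> \<le> 1"
  obtains f :: "nat \<Rightarrow> ('x \<Rightarrow>\<^sub>L real)" and x :: "nat \<Rightarrow> 'x"
  where "\<forall>i. norm (f i) \<le> 1" "\<forall>i<n. 1 - \<eta> \<le> f i (z i)" "\<forall>i<n. 1 - \<eta> \<le> f i (x i)"
    "\<forall>a. (\<forall>i<n. \<bar>a i\<bar> \<le> 1) \<longrightarrow> norm (\<Sum>i<n. a i *\<^sub>R x i) \<le> 1"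
proof -
  \<comment> \<open>The overlaps cost at most \<open>2 * n * n * \<theta>\<close> and the norms of
    the \<open>f i\<close> at most \<open>n * \<theta>\<close>; the final 1 makes
    \<open>\<eta>\<close> strictly exceed both together.\<close>
  define \<theta> where "\<theta> = \<eta> / (2 * real n * real n + real n + 1)"
  have den: "0 < 2 * real n * real n + real n + 1"
    by (simp add: add_nonneg_pos)
  have \<theta>: "0 < \<theta>"
    unfolding \<theta>_def using \<eta> den by simp
  have \<theta>_eq: "\<theta> * (2 * real n * real n + real n + 1) = \<eta>"
    unfolding \<theta>_def using den by simp
  have "\<theta> * 1 \<le> \<theta> * (2 * real n * real n + real n + 1)"
    using \<theta> by (intro mult_left_mono) auto
  then have \<theta>\<eta>: "\<theta> \<le> \<eta>"
    unfolding \<theta>_eq by simp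
  obtain f :: "nat \<Rightarrow> ('x \<Rightarrow>\<^sub>L real)" where
    "(\<forall>i. norm (f i) \<le> 1) \<and> (\<forall>i<n. 1 - \<theta> \<le> f i (z i)) \<and>
      (\<forall>i<n. \<forall>j<n. i \<noteq> j \<longrightarrow>
         2 - 2 * \<theta> \<le> norm (f i + f j) \<and> 2 - 2 * \<theta> \<le> norm (f i - f j))"
    using almost_disjoint_functionals[where z = z and n = n, OF oct z \<theta>] by blast
  then have f: "\<And>i. norm (f i) \<le> 1" "\<And>i. i < n \<Longrightarrow> 1 - \<theta> \<le> f i (z i)"
    "\<And>i j. i < n \<Longrightarrow> j < n \<Longrightarrow> i \<noteq> j \<Longrightarrow> 2 - 2 * \<theta> \<le> norm (f i + f j)"
    "\<And>i j. i < n \<Longrightarrow> j < n \<Longrightarrow> i \<noteq> j \<Longrightarrow> 2 - 2 * \<theta> \<le> norm (f i - f j)"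
    by auto
  have fz: "1 - \<eta> \<le> f i (z i)" if "i < n" for i
    using f(2)[OF that] \<theta>\<eta> by simp
  show thesis
  \<comment> \<open>The duality argument uses the constant \<open>n - \<eta>\<close>, which is
    negative for \<open>n = 0\<close>.\<close>
  proof (cases "n = 0")
    case True
    show thesis by (rule that[of f "\<lambda>i. 0"]) (simp_all add: True f(1))
  next
    case False
    obtain \<sigma> :: "nat \<Rightarrow> nat \<Rightarrow> real" and K :: nat where \<sigma>: "\<forall>m i. \<bar>\<sigma> m i\<bar> = 1"
      "\<forall>s. (\<forall>i. \<bar>s i\<bar> = 1) \<longrightarrow> (\<exists>m<K. \<forall>i<n. \<sigma> m i = s i)"
      by (rule finite_sign_enumeration[of n])
    have "\<exists>x b. (\<forall>m<K. norm (\<Sum>i<n. \<sigma> m i *\<^sub>R x i) \<le> b) \<and> 0 \<le> b \<and>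
        (real n - \<eta>) * b < (\<Sum>i<n. f i (x i))"
    proof (rule ccontr)
      assume none: "\<not> ?thesis"
      have le: "(\<Sum>i<n. f i (x i)) \<le> (real n - \<eta>) * b"
        if "\<And>m. m < K \<Longrightarrow> norm (\<Sum>i<n. \<sigma> m i *\<^sub>R x i) \<le> b" "0 \<le> b" for x b
      proof (rule ccontr)
        assume "\<not> ?thesis"
        with that have "\<exists>x b. (\<forall>m<K. norm (\<Sum>i<n. \<sigma> m i *\<^sub>R x i) \<le> b) \<and> 0 \<le> b \<and>
            (real n - \<eta>) * b < (\<Sum>i<n. f i (x i))"
          by (intro exI[of _ x] exI[of _ b]) simp
        with none show False by (rule notE)
      qed
      have "0 \<le> real n - \<eta>"
        using False \<eta>(2) by linarith
      then obtain h where h: "(\<Sum>m<K. norm (h m)) \<le> real n - \<eta>"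
        "\<And>i. i < n \<Longrightarrow> f i = (\<Sum>m<K. \<sigma> m i *\<^sub>R h m)"
        using functional_family_decomposition[where f = f and \<sigma> = \<sigma> and n = n and K = K, OF _ le]
        by blast
      have "(\<Sum>i<n. norm (f i)) \<le> (\<Sum>m<K. norm (h m)) + (\<Sum>i<n. \<Sum>j\<in>{..<n} - {i}.
          norm (f i) + norm (f j) - (norm (f i + f j) + norm (f i - f j)) / 2)"
        by (rule L1_sum_norm_le[OF T h(2)]) (simp_all add: \<sigma>(1))
      also have "(\<Sum>i<n. \<Sum>j\<in>{..<n} - {i}.
          norm (f i) + norm (f j) - (norm (f i + f j) + norm (f i - f j)) / 2)
          \<le> (\<Sum>i<n. real n * (2 * \<theta>))"
      proof (rule sum_mono)
        fix i assume i: "i \<in> {..<n}"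
        have "(\<Sum>j\<in>{..<n} - {i}.
            norm (f i) + norm (f j) - (norm (f i + f j) + norm (f i - f j)) / 2)
            \<le> (\<Sum>j\<in>{..<n} - {i}. 2 * \<theta>)"
        proof (rule sum_mono)
          fix j assume "j \<in> {..<n} - {i}"
          with i have ij: "i < n" "j < n" "i \<noteq> j" by auto
          show "norm (f i) + norm (f j) - (norm (f i + f j) + norm (f i - f j)) / 2 \<le> 2 * \<theta>"
            using f(3)[OF ij] f(4)[OF ij] f(1)[of i] f(1)[of j] by argo
        qed
        also have "\<dots> \<le> (\<Sum>j<n. 2 * \<theta>)"
          using \<theta> by (intro sum_mono2) auto
        finally show "(\<Sum>j\<in>{..<n} - {i}.
            norm (f i) + norm (f j) - (norm (f i + f j) + norm (f i - f j)) / 2)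
            \<le> real n * (2 * \<theta>)"
          by simp
      qed
      finally have upper: "(\<Sum>i<n. norm (f i)) \<le> real n - \<eta> + 2 * real n * real n * \<theta>"
        using h(1) by simp
      have "(\<Sum>i<n. 1 - \<theta>) \<le> (\<Sum>i<n. norm (f i))"
      proof (rule sum_mono)
        fix i assume "i \<in> {..<n}"
        then show "1 - \<theta> \<le> norm (f i)"
          using f(2)[of i] norm_blinfun[of "f i" "z i"] z[of i] by simp
      qed
      then have "real n - real n * \<theta> \<le> (\<Sum>i<n. norm (f i))"
        by (simp add: right_diff_distrib)
      with upper \<theta>_eq \<theta> show False by (simp add: algebra_simps)
    qed
    then obtain x b where b: "\<And>m. m < K \<Longrightarrow> norm (\<Sum>i<n. \<sigma> m i *\<^sub>R x i) \<le> b" "0 \<le> b"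
      and big: "(real n - \<eta>) * b < (\<Sum>i<n. f i (x i))"
      by blast
    have signs: "norm (\<Sum>i<n. s i *\<^sub>R x i) \<le> b" if s: "\<And>i. \<bar>s i\<bar> = 1" for s
    proof -
      obtain m where m: "m < K" "\<forall>i<n. \<sigma> m i = s i"
        using \<sigma>(2) s by blast
      have "(\<Sum>i<n. s i *\<^sub>R x i) = (\<Sum>i<n. \<sigma> m i *\<^sub>R x i)"
        using m(2) by (intro sum.cong) auto
      then show ?thesis using b(1)[OF m(1)] by simp
    qed
    have unit: "norm (\<Sum>i<n. a i *\<^sub>R x i) \<le> b" if "\<And>i. i < n \<Longrightarrow> \<bar>a i\<bar> \<le> 1" for a
      by (rule norm_sum_le_of_signs) (use signs that in auto)
    have fx_le: "f i (x i) \<le> b" if i: "i < n" for i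
    proof -
      have "(\<Sum>j<n. of_bool (j = i) *\<^sub>R x j) = x i"
        using i by (simp add: of_bool_def if_distrib[of "\<lambda>c. c *\<^sub>R x j" for j] cong: if_cong)
      with unit[of "\<lambda>j. of_bool (j = i)"] have "norm (x i) \<le> b" by simp
      moreover have "norm (f i (x i)) \<le> 1 * norm (x i)"
        by (rule order_trans[OF norm_blinfun]) (intro mult_right_mono f(1) norm_ge_zero)
      ultimately show ?thesis by simp
    qed
    \<comment> \<open>For \<open>b = 0\<close> every \<open>f i (x i)\<close> would be at most 0,
      against the strict inequality \<open>big\<close>.\<close>
    have b_pos: "0 < b"
    proof (rule ccontr)
      assume "\<not> 0 < b"
      with b(2) have "b = 0" by simp
      then have "(\<Sum>i<n. f i (x i)) \<le> 0"
        using fx_le by (intro sum_nonpos) auto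
      with big \<open>b = 0\<close> show False by simp
    qed
    \<comment> \<open>No term exceeds \<open>b\<close>, so a sum above
      \<open>(n - \<eta>) * b\<close> leaves at least \<open>(1 - \<eta>) * b\<close> for
      each.\<close>
    have fx: "(1 - \<eta>) * b \<le> f i (x i)" if i: "i < n" for i
    proof -
      have "(\<Sum>j<n. f j (x j)) = f i (x i) + (\<Sum>j\<in>{..<n} - {i}. f j (x j))"
        using i by (intro sum.remove) auto
      also have "(\<Sum>j\<in>{..<n} - {i}. f j (x j)) \<le> (\<Sum>j\<in>{..<n} - {i}. b)"
        by (intro sum_mono fx_le) auto
      also have "\<dots> = (real n - 1) * b"
        using i by (simp add: of_nat_diff)
      finally show ?thesis using big by (simp add: algebra_simps)
    qed
    show thesis
    proof (rule that[of f "\<lambda>i. x i /\<^sub>R b"])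
      show "\<forall>i. norm (f i) \<le> 1" using f(1) by simp
      show "\<forall>i<n. 1 - \<eta> \<le> f i (z i)" using fz by simp
      show "\<forall>i<n. 1 - \<eta> \<le> f i (x i /\<^sub>R b)"
        using fx b_pos by (simp add: blinfun.scaleR_right field_simps)
      show "\<forall>a. (\<forall>i<n. \<bar>a i\<bar> \<le> 1) \<longrightarrow> norm (\<Sum>i<n. a i *\<^sub>R (x i /\<^sub>R b)) \<le> 1"
      proof (intro allI impI)
        fix a :: "nat \<Rightarrow> real"
        assume "\<forall>i<n. \<bar>a i\<bar> \<le> 1"
        then have "norm (\<Sum>i<n. a i *\<^sub>R x i) \<le> b"
          by (intro unit) simp
        moreover have "(\<Sum>i<n. a i *\<^sub>R (x i /\<^sub>R b)) = (\<Sum>i<n. a i *\<^sub>R x i) /\<^sub>R b"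
          by (simp add: scaleR_sum_right mult.commute)
        ultimately show "norm (\<Sum>i<n. a i *\<^sub>R (x i /\<^sub>R b)) \<le> 1"
          using b_pos by (simp add: field_simps)
      qed
    qed
  qed
qed

lemma L1_predual_operator:
  fixes T :: "('x::real_normed_vector \<Rightarrow>\<^sub>L real) \<Rightarrow> 'm \<Rightarrow> real"
    and U :: "nat \<Rightarrow> ('y::real_normed_vector \<Rightarrow>\<^sub>L 'x)"
  assumes T: "dual_isometric_L1 M T" and oct: "octahedral TYPE('x)"
    and U: "\<And>i. i < n \<Longrightarrow> norm (U i) = 1" and \<delta>: "0 < \<delta>"
  shows "\<exists>S. norm S \<le> 1 \<and> (\<forall>i<n. 2 - \<delta> \<le> norm (U i + S))"
proof -
  \<comment> \<open>\<open>U i\<close> and \<open>S\<close> each lose at most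
    \<open>2 * \<eta>\<close> when tested with \<open>f i\<close> at \<open>y i\<close>.\<close>
  define \<eta> where "\<eta> = min 1 (\<delta> / 4)"
  have \<eta>: "0 < \<eta>" "\<eta> \<le> 1" "4 * \<eta> \<le> \<delta>"
    using \<delta> by (auto simp: \<eta>_def)
  \<comment> \<open>Nonvanishing is a separate demand because \<open>1 - \<eta>\<close> may be 0,
    while \<open>z i\<close> divides by \<open>norm (U i (y i))\<close>.\<close>
  have "\<exists>y. norm y = 1 \<and> 1 - \<eta> \<le> norm (U i y) \<and> U i y \<noteq> 0" if i: "i < n" for i
  proof (rule ccontr)
    define r where "r = max (1 - \<eta>) (1 / 2)"
    assume "\<not> ?thesis"
    then have *: "norm (U i y) \<le> r" if "norm y = 1" for y
      using that by (force simp: r_def)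
    have "norm (U i) \<le> r"
    proof (rule norm_blinfun_bound)
      show "0 \<le> r" by (simp add: r_def)
      show "norm (U i y) \<le> r * norm y" for y
        using *[of "y /\<^sub>R norm y"]
        by (cases "y = 0") (auto simp: blinfun.scaleR_right field_simps)
    qed
    then show False using U[OF i] \<eta> by (auto simp: r_def)
  qed
  then obtain y where y: "\<And>i. i < n \<Longrightarrow> norm (y i) = 1"
    "\<And>i. i < n \<Longrightarrow> 1 - \<eta> \<le> norm (U i (y i))" "\<And>i. i < n \<Longrightarrow> U i (y i) \<noteq> 0"
    by metis
  have "\<exists>g :: 'y \<Rightarrow>\<^sub>L real. norm g \<le> 1 \<and> blinfun_apply g (y i) = norm (y i)" for i
    using norming_functional[of "y i"] by metis
  then obtain g :: "nat \<Rightarrow> ('y \<Rightarrow>\<^sub>L real)" where g: "\<And>i. norm (g i) \<le> 1" "\<And>i. g i (y i) = norm (y i)"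
    by metis
  define z where "z i = U i (y i) /\<^sub>R norm (U i (y i))" for i
  have z: "norm (z i) = 1" if "i < n" for i
    using y(3)[OF that] by (simp add: z_def)
  obtain f :: "nat \<Rightarrow> ('x \<Rightarrow>\<^sub>L real)" and x :: "nat \<Rightarrow> 'x" where
    fzx: "\<forall>i. norm (f i) \<le> 1" "\<forall>i<n. 1 - \<eta> \<le> f i (z i)" "\<forall>i<n. 1 - \<eta> \<le> f i (x i)"
    and x_all: "\<forall>a. (\<forall>i<n. \<bar>a i\<bar> \<le> 1) \<longrightarrow> norm (\<Sum>i<n. a i *\<^sub>R x i) \<le> 1"
    by (rule L1_predual_l_infty_family[where z = z and n = n, OF T oct z \<eta>(1,2)])
  note f = fzx(1)[rule_format] and fz = fzx(2)[rule_format] and fx = fzx(3)[rule_format]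
  have x: "norm (\<Sum>i<n. a i *\<^sub>R x i) \<le> 1" if "\<And>i. i < n \<Longrightarrow> \<bar>a i\<bar> \<le> 1" for a
    using x_all that by blast
  define S where "S = (\<Sum>i<n. blinfun_scaleR_left (x i) o\<^sub>L g i)"
  have S: "S v = (\<Sum>i<n. g i v *\<^sub>R x i)" for v
    by (simp add: S_def blinfun.sum_left)
  have g_le: "\<bar>g i v\<bar> \<le> norm v" for i v
    using norm_blinfun[of "g i" v] mult_right_mono[OF g(1)[of i] norm_ge_zero[of v]] by simp
  have f_le: "f i v \<le> norm v" for i v
    using norm_blinfun[of "f i" v] mult_right_mono[OF f(1)[of i] norm_ge_zero[of v]] by simp
  have "norm S \<le> 1"
  proof (rule norm_blinfun_bound)
    fix v
    show "norm (S v) \<le> 1 * norm v"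
    proof (cases "v = 0")
      case False
      have "norm (\<Sum>i<n. (g i v / norm v) *\<^sub>R x i) \<le> 1"
        using g_le False by (intro x) simp
      moreover have "S v = norm v *\<^sub>R (\<Sum>i<n. (g i v / norm v) *\<^sub>R x i)"
        using False by (simp add: S scaleR_sum_right)
      ultimately show ?thesis
        using mult_left_mono[of _ 1 "norm v"] by simp
    qed simp
  qed simp
  moreover have "2 - \<delta> \<le> norm (U i + S)" if i: "i < n" for i
  proof -
    \<comment> \<open>Reflecting \<open>S (y i)\<close> in \<open>x i\<close> keeps coefficient 1 at
      \<open>x i\<close> and negates the others, so the result stays in the unit ball. Hence
      \<open>f i (S (y i))\<close> is at least \<open>2 * f i (x i) - 1\<close>, whatever the other
      \<open>g j\<close> do at \<open>y i\<close>.\<close>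
    define a where "a j = (if j = i then 1 else - g j (y i))" for j
    have "2 *\<^sub>R x i - S (y i) = (\<Sum>j<n. a j *\<^sub>R x j)"
    proof -
      have "S (y i) = x i + (\<Sum>j\<in>{..<n} - {i}. g j (y i) *\<^sub>R x j)"
        using i y(1) g(2) by (simp add: S sum.remove[of _ i])
      moreover have "(\<Sum>j<n. a j *\<^sub>R x j) = x i - (\<Sum>j\<in>{..<n} - {i}. g j (y i) *\<^sub>R x j)"
        using i by (simp add: sum.remove[of _ i] a_def sum_negf)
      ultimately show ?thesis by (simp add: scaleR_2)
    qed
    moreover have "norm (\<Sum>j<n. a j *\<^sub>R x j) \<le> 1"
      using g_le[of _ "y i"] y(1)[OF i] by (intro x) (auto simp: a_def)
    ultimately have "f i (2 *\<^sub>R x i - S (y i)) \<le> 1"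
      using f_le[of i "2 *\<^sub>R x i - S (y i)"] by simp
    then have fS: "1 - 2 * \<eta> \<le> f i (S (y i))"
      using fx[OF i] by (simp add: blinfun.diff_right blinfun.scaleR_right)
    have "U i (y i) = norm (U i (y i)) *\<^sub>R z i"
      using y(3)[OF i] by (simp add: z_def)
    then have "f i (U i (y i)) = norm (U i (y i)) * f i (z i)"
      by (metis blinfun.scaleR_right real_scaleR_def)
    moreover have "(1 - \<eta>) * (1 - \<eta>) \<le> norm (U i (y i)) * f i (z i)"
      using y(2)[OF i] fz[OF i] \<eta> by (intro mult_mono) auto
    moreover have "1 - 2 * \<eta> \<le> (1 - \<eta>) * (1 - \<eta>)"
      by (simp add: algebra_simps)
    ultimately have "1 - 2 * \<eta> \<le> f i (U i (y i))" by linarith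
    with fS have "2 - 4 * \<eta> \<le> f i ((U i + S) (y i))"
      by (simp add: blinfun.add_left blinfun.add_right)
    also have "\<dots> \<le> norm ((U i + S) (y i))"
      by (rule f_le)
    also have "\<dots> \<le> norm (U i + S)"
      using norm_blinfun[of "U i + S" "y i"] y(1)[OF i] by simp
    finally show ?thesis using \<eta>(3) by simp
  qed
  ultimately show ?thesis by blast
qed

theorem theorem4p6:
  fixes M :: "'m measure"
    and T :: "('x::banach \<Rightarrow>\<^sub>L real) \<Rightarrow> 'm \<Rightarrow> real"
  assumes "dual_isometric_L1 M T"
    and "octahedral TYPE('x)"
    and "\<exists>y::'y::banach. y \<noteq> 0"
  shows "octahedral TYPE('y \<Rightarrow>\<^sub>L 'x)"
proof -
  obtain y :: 'y where y: "y \<noteq> 0"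
    using assms(3) by blast
  \<comment> \<open>Octahedrality for the zero subspace already provides a unit vector of X; with a
    functional not vanishing at \<open>y\<close> it gives a nonzero rank-one operator, hence a unit
    vector of L(Y, X).\<close>
  obtain x :: 'x where x: "norm x = 1"
    using assms(2)[unfolded octahedral_def, rule_format, of "{}" 1] by auto
  obtain g :: "'y \<Rightarrow>\<^sub>L real" where g: "g y = norm y"
    by (rule norming_functional)
  define U0 where "U0 = blinfun_scaleR_left x o\<^sub>L g"
  have "U0 y \<noteq> 0"
    using x y g by (auto simp: U0_def)
  then have "U0 \<noteq> 0" by auto
  then have "norm (U0 /\<^sub>R norm U0) = 1" by simp
  then show ?thesis
  proof (rule octahedralI)
    fix F :: "('y \<Rightarrow>\<^sub>L 'x) set" and \<delta> :: real
    assume F: "finite F" "\<And>U. U \<in> F \<Longrightarrow> norm U = 1" and \<delta>: "\<delta> > 0"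
    obtain U where U: "bij_betw U {0..<card F} F"
      using ex_bij_betw_nat_finite[OF F(1)] by blast
    then have U_img: "F = U ` {0..<card F}"
      by (simp add: bij_betw_def)
    have "norm (U i) = 1" if "i < card F" for i
      using U_img that by (intro F(2)) auto
    from L1_predual_operator[where U = U and n = "card F", OF assms(1,2) this \<delta>]
    obtain S where "norm S \<le> 1" "\<forall>i<card F. 2 - \<delta> \<le> norm (U i + S)" by blast
    then show "\<exists>S. norm S \<le> 1 \<and> (\<forall>V\<in>F. 2 - \<delta> \<le> norm (V + S))"
      by (subst U_img) auto
  qed
qed

end
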